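(* Let $P\in C^2(\mathbb{R}^n,\mathbb{R}^n)$ and $Q\in C^1(\mathbb{R}^n\times[0,1],\mathbb{R}^n)$. Let $v_0\in\mathbb{R}^n$ be such that $P(v_0)=0$ and the matrix $P'(v_0)$ is singular. Let $\Pi:\mathbb{R}^n\to\mathbb{R}^n$ be a linear projector (not necessarily of rank one) that is invariant with respect to $P'(v_0)$ and satisfies $\Pi P'(v_0)=0$, and assume that $P'(v_0)$ is invertible on $(I-\Pi)\mathbb{R}^n$, i.e. the restriction $P'(v_0)|_{(I-\Pi)\mathbb{R}^n}:(I-\Pi)\mathbb{R}^n\to(I-\Pi)\mathbb{R}^n$ is bijective. Assume moreover that $\Pi Q(v_0,0)=0$, that $$\Pi P''(v_0)(\Pi r)(\Pi s)=0\quad\text{for all } r,s\in\mathbb{R}^n,$$ and that the linear operator $$h\mapsto -\Pi P''(v_0)\Big[(I-\Pi)\big(P'(v_0)|_{(I-\Pi)\mathbb{R}^n}\big)^{-1}Q(v_0,0)\Big]h+\Pi Q'_v(v_0,0)h$$ is invertible on $\Pi\mathbb{R}^n$ (as an operator from $\Pi\mathbb{R}^n$ to $\Pi\mathbb{R}^n$). Define, for $w\in\mathbb{R}^n$, $$\Psi(w,0)=\tfrac12\Pi P''(v_0)ww+\Pi Q'_v(v_0,0)w+\Pi Q'_\varepsilon(v_0,0)+(I-\Pi)P'(v_0)w+(I-\Pi)Q(v_0,0).$$ Then there exists a unique $w_0\in\mathbb{R}^n$ such that $\Psi(w_0,0)=0$, and the derivative $$\Psi'_w(w_0,0)=\Pi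 P''(v_0)w_0+\Pi Q'_v(v_0,0)+(I-\Pi)P'(v_0)$$ is a non-singular linear operator on $\mathbb{R}^n$.
   Context: $P'(v_0)$ is the Jacobian matrix of $P$ at $v_0$, and $P''(v_0)ab$ is the second derivative of $P$ at $v_0$ applied to the pair $(a,b)$ (a symmetric bilinear map with values in $\mathbb{R}^n$); $P''(v_0)w$ denotes the linear map $h\mapsto P''(v_0)wh$. $Q'_v$ and $Q'_\varepsilon$ denote the partial derivatives of $Q(v,\varepsilon)$ with respect to $v\in\mathbb{R}^n$ and $\varepsilon\in[0,1]$. A linear projector $\Pi$ ($\Pi^2=\Pi$) is called invariant with respect to $P'(v_0)$ if both $\mathrm{Im}\,\Pi$ and $\mathrm{Ker}\,\Pi$ are invariant subspaces of $P'(v_0)$. $I$ is the identity on $\mathbb{R}^n$. Since $\Pi Q(v_0,0)=0$, the vector $Q(v_0,0)$ lies in $(I-\Pi)\mathbb{R}^n$, so the inverse of the restriction can be applied to it. *)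

theory Defs
  imports "HOL-Analysis.Analysis"
begin

(* On a set such as R^n x [0,1] the derivative is taken relative to the set, so it is one-sided
   at the boundary. *)
definition C1_on :: "('a::real_normed_vector \<Rightarrow> 'b::real_normed_vector) \<Rightarrow> 'a set \<Rightarrow> bool" where
  "C1_on f S \<longleftrightarrow>
     (\<exists>f' :: 'a \<Rightarrow> 'a \<Rightarrow>\<^sub>L 'b.
        (\<forall>x\<in>S. (f has_derivative blinfun_apply (f' x)) (at x within S)) \<and> continuous_on S f')"

definition C2 :: "(real^'n \<Rightarrow> real^'m) \<Rightarrow> bool" where
  "C2 f \<longleftrightarrow> (\<forall>x. f differentiable (at x)) \<and> C1_on (\<lambda>x. jacobian f (at x)) UNIV"

(* f''(x) a b: differentiate the matrix-valued map f' at x in direction a, apply the result to b. *)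
definition second_deriv :: "(real^'n \<Rightarrow> real^'m) \<Rightarrow> real^'n \<Rightarrow> real^'n \<Rightarrow> real^'n \<Rightarrow> real^'m" where
  "second_deriv f x a b = frechet_derivative (\<lambda>y. jacobian f (at y)) (at x) a *v b"

definition deriv_v :: "((real^'n) \<times> real \<Rightarrow> real^'m) \<Rightarrow> real^'n \<Rightarrow> real \<Rightarrow> real^'n^'m" where
  "deriv_v Q v e = jacobian (\<lambda>u. Q (u, e)) (at v)"

definition deriv_eps :: "((real^'n) \<times> real \<Rightarrow> real^'m) \<Rightarrow> real^'n \<Rightarrow> real \<Rightarrow> real^'m" where
  "deriv_eps Q v e = vector_derivative (\<lambda>t. Q (v, t)) (at e within {0..1})"

definition projector :: "('a::real_vector \<Rightarrow> 'a) \<Rightarrow> bool" where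
  "projector p \<longleftrightarrow> linear p \<and> p \<circ> p = p"

definition invariant_projector :: "(real^'n \<Rightarrow> real^'n) \<Rightarrow> real^'n^'n \<Rightarrow> bool" where
  "invariant_projector p A \<longleftrightarrow> projector p \<and>
     (\<forall>x\<in>range p. A *v x \<in> range p) \<and> (\<forall>x\<in>{x. p x = 0}. A *v x \<in> {x. p x = 0})"

definition compl_proj :: "('a::real_vector \<Rightarrow> 'a) \<Rightarrow> 'a \<Rightarrow> 'a" where
  "compl_proj p x = x - p x"

(* The function w \<mapsto> Psi(w, 0). *)
definition Psi0 :: "(real^'n \<Rightarrow> real^'n) \<Rightarrow> ((real^'n) \<times> real \<Rightarrow> real^'n) \<Rightarrow> (real^'n \<Rightarrow> real^'n)
    \<Rightarrow> real^'n \<Rightarrow> real^'n \<Rightarrow> real^'n" where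
  "Psi0 P Q p v0 w =
     (1/2) *\<^sub>R p (second_deriv P v0 w w) + p (deriv_v Q v0 0 *v w) + p (deriv_eps Q v0 0)
     + compl_proj p (jacobian P (at v0) *v w) + compl_proj p (Q (v0, 0))"

end

theory Submission
  imports Defs
begin

text \<open>Write \<open>A = P'(v0)\<close>, \<open>B = P''(v0)\<close> and \<open>z = Q(v0, 0)\<close>. Since \<open>p A = 0\<close> and \<open>A p = 0\<close>, the
  \<open>(I - p)\<close>-part of \<open>\<Psi>(w, 0) = 0\<close> reads \<open>A (w - p w) = -z\<close>, which forces \<open>w = p w - u\<close> with \<open>u\<close> the
  preimage of \<open>z\<close>. As \<open>p B\<close> vanishes on the range of \<open>p\<close>, the quadratic term of the \<open>p\<close>-part becomes
  affine in \<open>p w\<close>, and its linear part is exactly the operator assumed to be invertible. The same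
  splitting shows that the derivative has trivial kernel.\<close>

section \<open>Symmetry of the second derivative\<close>

text \<open>Mean value inequality for a first difference of \<open>f\<close> in direction
  \<open>b\<close>, followed along the segment in direction \<open>a\<close>. Its derivative
  compares \<open>f'\<close> at two points near \<open>x\<close>, each contributing one
  linearization error; hence the factor 2.\<close>

lemma second_difference_bound:
  fixes f :: "'a::real_normed_vector \<Rightarrow> 'b::real_normed_vector"
  assumes f: "\<And>y. (f has_derivative f' y) (at y)"
    and lin: "linear D"
    and bnd: "\<And>h. norm h \<le> t * (norm a + norm b) \<Longrightarrow> norm (f' (x + h) a - f' x a - D h) \<le> e * norm h"
    and "0 \<le> t" "0 \<le> e"
  shows "norm (f (x + t *\<^sub>R a + t *\<^sub>R b) - f (x + t *\<^sub>R a) - f (x + t *\<^sub>R b) + f x - t\<^sup>2 *\<^sub>R D b)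
           \<le> 2 * e * t\<^sup>2 * (norm a + norm b)"
proof -
  define K where "K = norm a + norm b"
  define C where "C = 2 * e * t\<^sup>2 * K"
  \<comment> \<open>\<open>g 1 - g 0\<close> is exactly the vector to be bounded; the term linear in
    \<open>s\<close> spreads the correction evenly over [0,1].\<close>
  define g where
    "g s = f (x + t *\<^sub>R b + s *\<^sub>R (t *\<^sub>R a)) - f (x + s *\<^sub>R (t *\<^sub>R a)) - s *\<^sub>R (t\<^sup>2 *\<^sub>R D b)" for s :: real
  define g' where
    "g' s = f' (x + t *\<^sub>R b + s *\<^sub>R (t *\<^sub>R a)) (t *\<^sub>R a) - f' (x + s *\<^sub>R (t *\<^sub>R a)) (t *\<^sub>R a) - t\<^sup>2 *\<^sub>R D b"
    for s :: real
  interpret D: linear D by (rule lin)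
  have line: "((\<lambda>s. f (y + s *\<^sub>R k)) has_vector_derivative f' (y + s *\<^sub>R k) k) (at s)" for y k s
  proof -
    have "((\<lambda>s. f (y + s *\<^sub>R k)) has_derivative (\<lambda>h. f' (y + s *\<^sub>R k) (h *\<^sub>R k))) (at s)"
      by (rule has_derivative_compose[OF _ f]) (auto intro!: derivative_eq_intros)
    moreover have "linear (f' (y + s *\<^sub>R k))"
      using f has_derivative_linear by blast
    ultimately show ?thesis
      by (simp add: has_vector_derivative_def linear_cmul)
  qed
  have g: "(g has_vector_derivative g' s) (at s)" for s
    unfolding g_def g'_def
    using has_vector_derivative_scaleR[OF DERIV_ident has_vector_derivative_const[of "t\<^sup>2 *\<^sub>R D b"], of s UNIV]
    by (intro has_vector_derivative_diff line) simp
  have bound: "norm (g' s) \<le> C" if s: "0 < s" "s < 1" for s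
  proof -
    have sc: "f' y (t *\<^sub>R a) = t *\<^sub>R f' y a" for y
      using f[of y, THEN has_derivative_linear] by (simp add: linear_cmul)
    have sa: "norm (s *\<^sub>R (t *\<^sub>R a)) \<le> t * norm a"
      using s \<open>0 \<le> t\<close> by (simp add: mult_left_le_one_le mult_right_mono)
    have n1: "norm (t *\<^sub>R b + s *\<^sub>R (t *\<^sub>R a)) \<le> t * K"
      using norm_triangle_ineq[of "t *\<^sub>R b" "s *\<^sub>R (t *\<^sub>R a)"] sa \<open>0 \<le> t\<close>
      by (simp add: K_def algebra_simps)
    have "t * norm a \<le> t * K"
      using \<open>0 \<le> t\<close> by (simp add: K_def mult_left_mono)
    then have n2: "norm (s *\<^sub>R (t *\<^sub>R a)) \<le> t * K"
      using sa by linarith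
    define E where "E h = f' (x + h) a - f' x a - D h" for h
    have E: "norm (E h) \<le> e * (t * K)" if "norm h \<le> t * K" for h
      using bnd[of h] that \<open>0 \<le> e\<close> mult_left_mono[OF that \<open>0 \<le> e\<close>]
      unfolding E_def K_def by linarith
    \<comment> \<open>The two values \<open>f' x a\<close> cancel, and the displacements differ by
      \<open>t *\<^sub>R b\<close>, so after the factor \<open>t\<close> the linear parts differ by
      exactly \<open>t\<^sup>2 *\<^sub>R D b\<close>.\<close>
    have "g' s = t *\<^sub>R (E (t *\<^sub>R b + s *\<^sub>R (t *\<^sub>R a)) - E (s *\<^sub>R (t *\<^sub>R a)))"
      unfolding g'_def E_def sc
      by (simp add: algebra_simps D.add D.scale power2_eq_square)
    then have "norm (g' s) \<le> t * (norm (E (t *\<^sub>R b + s *\<^sub>R (t *\<^sub>R a))) + norm (E (s *\<^sub>R (t *\<^sub>R a))))"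
      using \<open>0 \<le> t\<close> by (simp add: mult_left_mono norm_triangle_ineq4)
    also have "\<dots> \<le> t * (e * (t * K) + e * (t * K))"
      using E[OF n1] E[OF n2] \<open>0 \<le> t\<close> by (intro mult_left_mono add_mono)
    also have "\<dots> = C"
      by (simp add: C_def power2_eq_square)
    finally show ?thesis .
  qed
  have "norm (g 1 - g 0) \<le> (\<lambda>s. C * s) 1 - (\<lambda>s. C * s) 0"
  proof (rule differentiable_bound_general)
    show "continuous_on {0..1} g"
      using g by (meson continuous_at_imp_continuous_on has_vector_derivative_continuous)
    show "((\<lambda>s. C * s) has_vector_derivative C) (at s)" for s
      by (auto intro!: derivative_eq_intros simp: has_real_derivative_iff_has_vector_derivative[symmetric])
  qed (use g bound in \<open>auto intro!: continuous_intros\<close>)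
  then show ?thesis
    by (simp add: g_def C_def K_def algebra_simps)
qed

text \<open>Schwarz's theorem at a single point: for every e > 0 one second difference with a small
  step determines both values up to a multiple of e.\<close>

lemma second_derivative_symmetric:
  fixes f :: "'a::real_normed_vector \<Rightarrow> 'b::real_normed_vector"
  assumes f: "\<And>y. (f has_derivative f' y) (at y)"
    and a: "((\<lambda>y. f' y a) has_derivative Da) (at x)"
    and b: "((\<lambda>y. f' y b) has_derivative Db) (at x)"
  shows "Da b = Db a"
proof -
  define K where "K = norm a + norm b"
  have small: "norm (Da b - Db a) \<le> 4 * e * K" if "e > 0" for e
  proof -
    have approx: "\<exists>d>0. \<forall>h. norm h < d \<longrightarrow> norm (f' (x + h) c - f' x c - Dc h) \<le> e * norm h"
      if "((\<lambda>y. f' y c) has_derivative Dc) (at x)" for c Dc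
    proof -
      from that obtain d where "d > 0"
        and "\<And>y. norm (y - x) < d \<Longrightarrow> norm (f' y c - f' x c - Dc (y - x)) \<le> e * norm (y - x)"
        using \<open>e > 0\<close> unfolding has_derivative_at_alt by blast
      then show ?thesis
        by (metis add_diff_cancel_left')
    qed
    obtain d1 where d1: "d1 > 0"
      "\<And>h. norm h < d1 \<Longrightarrow> norm (f' (x + h) a - f' x a - Da h) \<le> e * norm h"
      using approx[OF a] by blast
    obtain d2 where d2: "d2 > 0"
      "\<And>h. norm h < d2 \<Longrightarrow> norm (f' (x + h) b - f' x b - Db h) \<le> e * norm h"
      using approx[OF b] by blast
    \<comment> \<open>Dividing by \<open>K + 1\<close> covers \<open>K = 0\<close> and makes
      \<open>t * K\<close> strictly smaller than both radii.\<close>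
    define t where "t = min d1 d2 / (K + 1)"
    have "K \<ge> 0" by (simp add: K_def)
    then have "t > 0" using d1 d2 by (simp add: t_def)
    have "t * K < t * (K + 1)" using \<open>t > 0\<close> by simp
    also have "\<dots> = min d1 d2" using \<open>K \<ge> 0\<close> by (simp add: t_def)
    finally have tK: "t * K < d1" "t * K < d2" by auto
    \<comment> \<open>\<open>S\<close> is symmetric in \<open>a\<close> and \<open>b\<close>, so both \<open>Da b\<close> and \<open>Db a\<close> approximate \<open>S / t\<^sup>2\<close>.\<close>
    define S where "S = f (x + t *\<^sub>R a + t *\<^sub>R b) - f (x + t *\<^sub>R a) - f (x + t *\<^sub>R b) + f x"
    have 1: "norm (S - t\<^sup>2 *\<^sub>R Da b) \<le> 2 * e * t\<^sup>2 * K"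
      unfolding S_def K_def
      by (rule second_difference_bound[OF f has_derivative_linear[OF a]])
        (use d1 tK \<open>t > 0\<close> \<open>e > 0\<close> in \<open>auto simp: K_def\<close>)
    have "norm (f (x + t *\<^sub>R b + t *\<^sub>R a) - f (x + t *\<^sub>R b) - f (x + t *\<^sub>R a) + f x - t\<^sup>2 *\<^sub>R Db a)
        \<le> 2 * e * t\<^sup>2 * (norm b + norm a)"
      by (rule second_difference_bound[OF f has_derivative_linear[OF b]])
        (use d2 tK \<open>t > 0\<close> \<open>e > 0\<close> in \<open>auto simp: K_def add.commute\<close>)
    then have 2: "norm (S - t\<^sup>2 *\<^sub>R Db a) \<le> 2 * e * t\<^sup>2 * K"
      by (simp add: S_def K_def algebra_simps)
    have "t\<^sup>2 * norm (Da b - Db a) = norm ((S - t\<^sup>2 *\<^sub>R Db a) - (S - t\<^sup>2 *\<^sub>R Da b))"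
      by (simp flip: scaleR_diff_right)
    also have "\<dots> \<le> t\<^sup>2 * (4 * e * K)"
      using norm_triangle_ineq4[of "S - t\<^sup>2 *\<^sub>R Db a" "S - t\<^sup>2 *\<^sub>R Da b"] 1 2 by (simp add: algebra_simps)
    finally show ?thesis
      using \<open>t > 0\<close> by simp
  qed
  \<comment> \<open>The choice e = r / (4 (K + 1)) turns the bound 4 e K into at most r.\<close>
  have "norm (Da b - Db a) \<le> 0"
  proof (rule field_le_epsilon)
    fix r :: real
    assume "r > 0"
    have "K \<ge> 0" by (simp add: K_def)
    with \<open>r > 0\<close> have "norm (Da b - Db a) \<le> 4 * (r / (4 * (K + 1))) * K"
      by (intro small) auto
    also have "\<dots> \<le> r"
      using \<open>r > 0\<close> \<open>K \<ge> 0\<close> by (simp add: field_simps)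
    finally show "norm (Da b - Db a) \<le> 0 + r" by simp
  qed
  then show ?thesis by simp
qed

text \<open>Multiplying a matrix by a fixed vector is bounded linear in the matrix, so it commutes
  with differentiating the Jacobian; this yields the directional derivatives of \<open>f'\<close> to
  which Schwarz's theorem applies.\<close>

lemma second_deriv_bilinear_symmetric:
  fixes f :: "real^'n \<Rightarrow> real^'m"
  assumes "C2 f"
  shows "bilinear (second_deriv f x)" and "second_deriv f x a b = second_deriv f x b a"
proof -
  have diff: "f differentiable (at y)" for y
    using assms by (simp add: C2_def)
  define J where "J = (\<lambda>y. jacobian f (at y))"
  define D where "D = frechet_derivative J (at x)"
  have "J differentiable (at x)"
    using assms unfolding C2_def C1_on_def J_def by (auto simp: differentiable_def)
  then have J: "(J has_derivative D) (at x)"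
    by (simp add: D_def frechet_derivative_works)
  then have "linear D"
    by (rule has_derivative_linear)
  have sd: "second_deriv f x a b = D a *v b" for a b
    by (simp add: second_deriv_def D_def J_def)
  have row: "linear (\<lambda>M :: real^'n^'m. M *v b)" for b
    by (intro linearI) (simp_all add: matrix_vector_mult_add_rdistrib scaleR_matrix_vector_assoc)
  show "bilinear (second_deriv f x)"
    unfolding bilinear_def sd
    using linear_compose[OF \<open>linear D\<close> row] by (auto simp: o_def)
  have "(f has_derivative (\<lambda>h. J y *v h)) (at y)" for y
    using diff jacobian_works unfolding J_def by blast
  moreover have "((\<lambda>y. J y *v c) has_derivative (\<lambda>h. D h *v c)) (at x)" for c
    using bounded_linear.has_derivative[OF linear_conv_bounded_linear[THEN iffD1, OF row] J] .
  ultimately show "second_deriv f x a b = second_deriv f x b a"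
    unfolding sd by (intro second_derivative_symmetric[symmetric])
qed

section \<open>Solving the projected quadratic equation\<close>

text \<open>Pure linear algebra: the derivatives of P and Q enter only as the coefficients
  \<open>A\<close>, \<open>B\<close>, \<open>D\<close>, \<open>c\<close>, and \<open>u\<close>
  stands for the preimage of \<open>z\<close> in the kernel of \<open>p\<close>.\<close>

lemma projected_quadratic_equation:
  fixes p A D :: "'a::euclidean_space \<Rightarrow> 'a" and B :: "'a \<Rightarrow> 'a \<Rightarrow> 'a" and c :: 'a
  assumes "projector p" "linear A" "linear D" "bilinear B"
    and sym: "\<And>a b. B a b = B b a"
    and pA: "\<And>x. p (A x) = 0" and Ap: "\<And>x. A (p x) = 0"
    and inj: "inj_on A (range (compl_proj p))"
    and u: "p u = 0" "A u = z"
    and B0: "\<And>r s. p (B (p r) (p s)) = 0"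
    and M: "bij_betw (\<lambda>h. - p (B u h) + p (D h)) (range p) (range p)"
  defines "F \<equiv> \<lambda>w. (1/2) *\<^sub>R p (B w w) + p (D w) + p c + compl_proj p (A w) + compl_proj p z"
  shows "\<exists>!w. F w = 0"
    and "F w = 0 \<Longrightarrow> bij (\<lambda>h. p (B w h) + p (D h) + compl_proj p (A h))"
proof -
  have lp: "linear p" and pp: "p (p x) = p x" for x
    using \<open>projector p\<close> by (auto simp: projector_def fun_eq_iff)
  interpret p: linear p by (rule lp)
  interpret A: linear A by fact
  interpret D: linear D by fact
  have Bl: "linear (\<lambda>y. B x y)" and Br: "linear (\<lambda>x. B x y)" for x y
    using \<open>bilinear B\<close> by (auto simp: bilinear_def)
  have B_diff: "B x (y - y') = B x y - B x y'" "B (x - x') y = B x y - B x' y" for x y x' y'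
    using linear_diff[OF Bl] linear_diff[OF Br] by auto
  have qA: "compl_proj p (A x) = A x" for x
    by (simp add: compl_proj_def pA)
  have pz: "p z = 0"
    using pA u(2) by auto
  \<comment> \<open>The kernel of \<open>p\<close> is the range of \<open>compl_proj p\<close>, so
    \<open>A\<close> can be cancelled between vectors killed by \<open>p\<close>.\<close>
  have A0: "x = y" if "p x = 0" "p y = 0" "A x = A y" for x y
  proof (rule inj_onD[OF inj])
    show "x \<in> range (compl_proj p)" "y \<in> range (compl_proj p)"
      using that by (auto simp: compl_proj_def image_iff intro: exI[of _ x] exI[of _ y])
  qed fact
  \<comment> \<open>Linear part and constant term of the \<open>p\<close>-part after substituting
    \<open>w = h - u\<close> with \<open>h\<close> in the range of \<open>p\<close>.\<close>
  define M where "M h = - p (B u h) + p (D h)" for h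
  define k where "k = (1/2) *\<^sub>R p (B u u) - p (D u) + p c"
  have pMk: "p (M h) = M h" "p k = k" for h
    by (simp_all add: M_def k_def p.add p.diff p.neg p.scale pp)
  have split: "p (F w) = (1/2) *\<^sub>R p (B w w) + p (D w) + p c" "F w - p (F w) = A w + z" for w
    by (simp_all add: F_def qA p.add p.scale pp pA pz) (simp_all add: compl_proj_def pz)
  \<comment> \<open>The pure term in \<open>h\<close> vanishes under \<open>p\<close>, and by
    symmetry the cross term occurs twice, which cancels the factor 1/2.\<close>
  have restrict: "(1/2) *\<^sub>R p (B (h - u) (h - u)) + p (D (h - u)) + p c = M h + k"
    if "p h = h" for h
  proof -
    have "p (B h h) = 0"
      using B0[of h h] that by simp
    then have "p (B (h - u) (h - u)) = p (B u u) - 2 *\<^sub>R p (B u h)"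
      by (simp add: B_diff p.diff sym[of h u] scaleR_2)
    then show ?thesis
      using that by (simp add: D.diff p.diff M_def k_def scaleR_diff_right)
  qed
  have iff: "F w = 0 \<longleftrightarrow> w = p w - u \<and> M (p w) + k = 0" for w
  proof -
    have "F w = 0 \<longleftrightarrow> p (F w) = 0 \<and> F w - p (F w) = 0"
      by (auto simp: p.zero)
    also have "\<dots> \<longleftrightarrow> p (F w) = 0 \<and> w = p w - u"
    proof -
      have "A w + z = 0 \<longleftrightarrow> w = p w - u"
      proof
        assume "A w + z = 0"
        \<comment> \<open>Both \<open>p w - w\<close> and \<open>u\<close> lie in the kernel of
          \<open>p\<close>, so \<open>A\<close> can be cancelled here.\<close>
        then have "A (p w - w) = A u"
          by (simp add: A.diff Ap u(2) add_eq_0_iff)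
        then have "p w - w = u"
          using A0[of "p w - w" u] u by (simp add: p.diff pp)
        then show "w = p w - u" by (simp add: algebra_simps)
      next
        assume "w = p w - u"
        then have "A w = A (p w - u)" by simp
        then show "A w + z = 0" by (simp add: A.diff Ap u(2))
      qed
      then show ?thesis by (simp only: split(2))
    qed
    also have "\<dots> \<longleftrightarrow> w = p w - u \<and> M (p w) + k = 0"
      using restrict[of "p w"] by (auto simp: split pp)
    finally show ?thesis .
  qed
  have bij: "bij_betw M (range p) (range p)"
    using M unfolding M_def .
  \<comment> \<open>Surjectivity of \<open>M\<close> on the range of \<open>p\<close> provides the
    \<open>p\<close>-component \<open>h\<close> of the solution \<open>h - u\<close>; injectivity
    gives uniqueness.\<close>
  have "- k \<in> range p"
    by (metis p.neg pMk(2) rangeI)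
  then obtain h where h: "h \<in> range p" "M h = - k"
    using bij by (metis bij_betw_imp_surj_on imageE)
  have ph: "p h = h"
    using h(1) pp by auto
  show "\<exists>!w. F w = 0"
  proof (rule ex1I[of _ "h - u"])
    show "F (h - u) = 0"
      using h ph by (simp add: iff p.diff u(1))
  next
    fix w
    assume "F w = 0"
    then have w: "w = p w - u" "M (p w) = - k"
      by (auto simp: iff add_eq_0_iff2)
    then have "p w = h"
      using h bij by (metis bij_betw_def inj_onD rangeI)
    then show "w = h - u"
      using w(1) by simp
  qed
  assume "F w = 0"
  then have w: "w = p w - u"
    by (simp add: iff)
  let ?L = "\<lambda>h. p (B w h) + p (D h) + compl_proj p (A h)"
  have L: "linear ?L"
    unfolding qA
    using linear_compose_add[OF linear_compose_add[OF linear_compose[OF Bl lp] linear_compose[OF \<open>linear D\<close> lp]]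
        \<open>linear A\<close>]
    by (simp add: o_def)
  have "x = 0" if "?L x = 0" for x
  proof -
    have "p (?L x) = p (B w x) + p (D x)" "?L x - p (?L x) = A x"
      by (simp_all add: qA p.add pp pA)
    with that have Bx: "p (B w x) + p (D x) = 0" and "A x = 0"
      by (simp_all add: p.zero)
    then have "A (x - p x) = A 0"
      by (simp add: A.diff Ap A.zero)
    then have px: "p x = x"
      using A0[of "x - p x" 0] by (simp add: p.diff pp p.zero)
    \<comment> \<open>Here the root property enters: \<open>p\<close> kills
      \<open>B (p w) x\<close>, as both arguments lie in its range, so the linearized equation
      reduces to \<open>M x = 0\<close>.\<close>
    have "B w x = B (p w) x - B u x"
      by (subst w) (rule B_diff)
    then have "M x = 0"
      using Bx B0[of w x] by (simp add: M_def p.diff px)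
    moreover have "M 0 = 0"
      by (simp add: M_def D.zero linear_0[OF Bl] p.zero)
    moreover have "x \<in> range p" "0 \<in> range p"
      using px p.zero by (metis rangeI)+
    ultimately show "x = 0"
      using bij by (metis bij_betw_def inj_onD)
  qed
  then have "inj ?L"
    using L linear_injective_0 by blast
  then show "bij ?L"
    using L linear_injective_imp_surjective by (auto simp: bij_def)
qed

section \<open>Differentiating the projected quadratic map\<close>

text \<open>The product rule gives \<open>B w h + B h w\<close>, which symmetry turns into twice
  \<open>B w h\<close>, absorbing the factor 1/2.\<close>

lemma has_derivative_projected_quadratic:
  fixes p A D :: "'a::euclidean_space \<Rightarrow> 'a" and B :: "'a \<Rightarrow> 'a \<Rightarrow> 'a"
  assumes "linear p" "linear A" "linear D" "bilinear B" and sym: "\<And>a b. B a b = B b a"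
  shows "((\<lambda>w. (1/2) *\<^sub>R p (B w w) + p (D w) + p c + compl_proj p (A w) + d) has_derivative
          (\<lambda>h. p (B w h) + p (D h) + compl_proj p (A h))) (at w)"
proof -
  interpret p: linear p by fact
  have lin: "(f has_derivative f) (at x)" if "linear f" for f :: "'a \<Rightarrow> 'a" and x
    using that by (simp add: linear_conv_bounded_linear bounded_linear_imp_has_derivative)
  have "((\<lambda>w. B w w) has_derivative (\<lambda>h. B w h + B h w)) (at w)"
    using bounded_bilinear.FDERIV[OF bilinear_conv_bounded_bilinear[THEN iffD1, OF assms(4)]
        has_derivative_ident has_derivative_ident] .
  then have "((\<lambda>w. p (B w w)) has_derivative (\<lambda>h. p (B w h + B h w))) (at w)"
    by (rule has_derivative_compose[OF _ lin[OF assms(1)]])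
  then have 1: "((\<lambda>w. (1/2) *\<^sub>R p (B w w)) has_derivative (\<lambda>h. p (B w h))) (at w)"
    by (rule has_derivative_eq_rhs[OF has_derivative_scaleR_right])
      (simp add: sym[of _ w] p.scale fun_eq_iff flip: scaleR_2)
  have "linear (\<lambda>h. p (D h))" "linear (\<lambda>h. compl_proj p (A h))"
    using linear_compose[OF \<open>linear D\<close> \<open>linear p\<close>]
      linear_compose_sub[OF \<open>linear A\<close> linear_compose[OF \<open>linear A\<close> \<open>linear p\<close>]]
    by (simp_all add: o_def compl_proj_def)
  then show ?thesis
    using has_derivative_add[OF has_derivative_add[OF has_derivative_add[OF has_derivative_add[OF 1 lin]
          has_derivative_const[of "p c"]] lin] has_derivative_const[of d]]
    by simp
qed

section \<open>Application to P and Q\<close>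

theorem theorem1:
  fixes P :: "real^'n \<Rightarrow> real^'n"
    and Q :: "(real^'n) \<times> real \<Rightarrow> real^'n"
    and v0 :: "real^'n"
    and p :: "real^'n \<Rightarrow> real^'n"
  assumes "C2 P"
    and "C1_on Q (UNIV \<times> {0..1})"
    and "P v0 = 0"
    and "\<not> invertible (jacobian P (at v0))"
    and "invariant_projector p (jacobian P (at v0))"
    and "\<forall>x. p (jacobian P (at v0) *v x) = 0"
    and "bij_betw (\<lambda>x. jacobian P (at v0) *v x) (range (compl_proj p)) (range (compl_proj p))"
    and "p (Q (v0, 0)) = 0"
    and "\<forall>r s. p (second_deriv P v0 (p r) (p s)) = 0"
    and "bij_betw
      (\<lambda>h. - p (second_deriv P v0
                 (compl_proj p
                   (inv_into (range (compl_proj p)) (\<lambda>x. jacobian P (at v0) *v x) (Q (v0, 0)))) h)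
           + p (deriv_v Q v0 0 *v h))
      (range p) (range p)"
  shows "(\<exists>!w0. Psi0 P Q p v0 w0 = 0) \<and>
    (\<forall>w0. Psi0 P Q p v0 w0 = 0 \<longrightarrow>
      (let L = (\<lambda>h. p (second_deriv P v0 w0 h) + p (deriv_v Q v0 0 *v h)
                    + compl_proj p (jacobian P (at v0) *v h))
       in (Psi0 P Q p v0 has_derivative L) (at w0) \<and> bij L))"
proof -
  let ?A = "\<lambda>x. jacobian P (at v0) *v x" and ?D = "\<lambda>x. deriv_v Q v0 0 *v x"
    and ?B = "second_deriv P v0" and ?R = "range (compl_proj p)"
  define z where "z = Q (v0, 0)"
  define u0 where "u0 = inv_into ?R ?A z"
  define u where "u = compl_proj p u0"
  have proj: "projector p" and inv: "\<And>x. x \<in> range p \<Longrightarrow> ?A x \<in> range p"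
    using assms(5) by (auto simp: invariant_projector_def)
  have lp: "linear p" and pp: "p (p x) = p x" for x
    using proj by (auto simp: projector_def fun_eq_iff)
  have kernel: "compl_proj p x = x" if "p x = 0" for x
    using that by (simp add: compl_proj_def)
  have range_kernel: "p x = 0" if "x \<in> ?R" for x
    using that pp by (auto simp: compl_proj_def linear_diff[OF lp])
  \<comment> \<open>Invariance puts \<open>?A (p x)\<close> in the range of \<open>p\<close>, where
    \<open>p\<close> is the identity, while \<open>p\<close> annihilates every value of
    \<open>?A\<close>.\<close>
  have Ap: "?A (p x) = 0" for x
  proof -
    have "p (?A (p x)) = ?A (p x)"
      using inv[of "p x"] pp by auto
    then show ?thesis
      using assms(6) by simp
  qed
  \<comment> \<open>Since \<open>z\<close> lies in the image of \<open>?R\<close> under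
    \<open>?A\<close>, \<open>inv_into\<close> returns a genuine preimage rather than an unspecified
    value.\<close>
  have "z \<in> ?R"
    using kernel[of z] assms(8) by (metis rangeI z_def)
  then have "z \<in> ?A ` ?R"
    using assms(7) by (simp add: bij_betw_def)
  then have u0: "u0 \<in> ?R" "?A u0 = z"
    unfolding u0_def by (rule inv_into_into, rule f_inv_into_f)
  \<comment> \<open>\<open>u0\<close> lies in the kernel of \<open>p\<close>, so \<open>u\<close>
    coincides with it and inherits \<open>?A u0 = z\<close>.\<close>
  then have u: "p u = 0" "?A u = z"
    using range_kernel[OF u0(1)] kernel[of u0] by (simp_all add: u_def)
  have inj: "inj_on ?A ?R"
    using assms(7) by (simp add: bij_betw_def)
  have M: "bij_betw (\<lambda>h. - p (?B u h) + p (?D h)) (range p) (range p)"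
    using assms(10) by (simp add: u_def u0_def z_def)
  note B = second_deriv_bilinear_symmetric[OF assms(1), of v0]
  have Psi: "Psi0 P Q p v0 = (\<lambda>w. (1/2) *\<^sub>R p (?B w w) + p (?D w) + p (deriv_eps Q v0 0)
      + compl_proj p (?A w) + compl_proj p z)"
    by (simp add: fun_eq_iff Psi0_def z_def)
  note solve = projected_quadratic_equation[OF proj matrix_vector_mul_linear matrix_vector_mul_linear B
      _ Ap inj u _ M, where c = "deriv_eps Q v0 0"]
  show ?thesis
    unfolding Psi Let_def
    using solve assms(6,9)
      has_derivative_projected_quadratic[OF lp matrix_vector_mul_linear matrix_vector_mul_linear B]
    by blast
qed

end
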